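(* Let $V(N)$ be the stationary speed of the $N$-counter system. As $N\to\infty$, $$V(N)\ge (1+o(1))\left(1+\frac{\sqrt{3}}{27}\right).$$
   Context: The $N$-counter system: there are $N$ counters taking integer values. At every time step $t=0,1,2,\ldots$ an (unordered) pair of distinct counters is selected uniformly at random among the $\binom N2$ pairs, independently over steps. If the states of the two selected counters are different, the smaller one is increased by $1$; if they are equal, both are increased by $1$. It is assumed that the system starts from a configuration with at least two counters at the highest level; then at all times there are at least two counters at the highest level. Gap process: order the counters from largest to smallest; for $j=1,\ldots,N-2$ let $X_j(t)\ge 0$ be the difference between the values of the $(j+1)$-th largest and the $(j+2)$-th largest counter after $t$ steps. For $N\ge 3$, $X(t)=(X_1(t),\ldots,X_{N-2}(t))$ is a positive recurrent Markov chain on $\mathbb{Z}_+^{N-2}$ with stationary distribution $\pi$. Speed: $V(N)$ is the expected number of counters updated (increased) in one time step when $X(0)$ is distributed according to $\pi$. Explicitly, if a state $x\in\mathbb{Z}_+^{N-2}$ corresponds to counters occupying $M$ distinct levels with $\alpha_1\ge 2$ counters at the highest level, $\alpha_2\ge1$ at the next occupied level, and so on up to $\alpha_M\ge 1$ at the lowest one ($\alpha_1+\cdots+\alpha_M=N$), then the expected number of counters updated from $x$ is $V_\alpha(N)=1+\sum_{i=1}^M\frac{\alpha_i(\alpha_i-1)}{N(N-1)}$, and $V(N)=\sum_{x}\pi(x)V_{\alpha(x)}(N)$. Here $o(1)$ denotes a quantity tending to $0$ as $N\to\infty$. *)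

theory Defs
  imports "HOL-Probability.Probability" "HOL-Combinatorics.Permutations" "HOL-Library.Landau_Symbols"
begin

section \<open>The counter system\<close>

text \<open>
  A configuration assigns to each counter \<open>i < N\<close> its value; values at indices \<open>\<ge> N\<close> are ignored.
\<close>

type_synonym config = "nat \<Rightarrow> int"

definition counter_pairs :: "nat \<Rightarrow> nat set set" where
  "counter_pairs N = {e. e \<subseteq> {..<N} \<and> card e = 2}"

text \<open>
  The counters of a selected pair that are increased are those of minimal value within the pair:
  the smaller one if the two values differ, and both if they agree.
\<close>

definition updated :: "config \<Rightarrow> nat set \<Rightarrow> nat set" where
  "updated c e = {i \<in> e. \<forall>j\<in>e. c i \<le> c j}"

definition advance :: "config \<Rightarrow> nat set \<Rightarrow> config" where
  "advance c e = (\<lambda>i. if i \<in> updated c e then c i + 1 else c i)"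

definition step :: "nat \<Rightarrow> config \<Rightarrow> config pmf" where
  "step N c = map_pmf (advance c) (pmf_of_set (counter_pairs N))"


section \<open>The gap process\<close>

text \<open>
  A state of the gap process is a list \<open>x\<close> of length \<open>N - 2\<close>. With zero-based list indices,
  \<open>s ! j\<close> below is the \<open>(j+1)\<close>-th largest counter value, and the \<open>j\<close>-th gap
  (\<open>1 \<le> j \<le> N - 2\<close>) is stored at position \<open>j - 1\<close> of the list.
\<close>

definition gaps :: "nat \<Rightarrow> config \<Rightarrow> nat list" where
  "gaps N c = (let s = rev (sort (map c [0..<N])) in map (\<lambda>j. nat (s ! j - s ! (j + 1))) [1..<N - 1])"

text \<open>
  A representative of the configurations with gaps \<open>x\<close> and at least two counters at the highest
  level: counters \<open>0\<close> and \<open>1\<close> (note the truncated subtraction) have value \<open>0\<close>, and counter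
  \<open>i \<ge> 2\<close> has value \<open>- (x\<^sub>1 + \<dots> + x\<^bsub>i-1\<^esub>)\<close>.
\<close>

definition config_of :: "nat list \<Rightarrow> config" where
  "config_of x i = - int (sum_list (take (i - 1) x))"

definition gap_kernel :: "nat \<Rightarrow> nat list \<Rightarrow> nat list pmf" where
  "gap_kernel N x = map_pmf (gaps N) (step N (config_of x))"

definition stationary :: "nat \<Rightarrow> nat list pmf \<Rightarrow> bool" where
  "stationary N p \<longleftrightarrow> set_pmf p \<subseteq> {x. length x = N - 2} \<and> bind_pmf p (gap_kernel N) = p"


section \<open>Speed\<close>

definition local_speed :: "nat \<Rightarrow> config \<Rightarrow> real" where
  "local_speed N c =
     measure_pmf.expectation (pmf_of_set (counter_pairs N)) (\<lambda>e. real (card (updated c e)))"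

text \<open>
  The expected number of counters updated in one step from the gap distribution \<open>p\<close>.
\<close>

definition speed :: "nat \<Rightarrow> nat list pmf \<Rightarrow> real" where
  "speed N p = measure_pmf.expectation p (\<lambda>x. local_speed N (config_of x))"


section \<open>Consistency of the definitions\<close>

lemma finite_counter_pairs [simp]: "finite (counter_pairs N)"
  by (rule finite_subset[of _ "Pow {..<N}"]) (auto simp: counter_pairs_def)

lemma card_counter_pairs: "card (counter_pairs N) = N choose 2"
  using n_subsets[of "{..<N}" 2] by (simp add: counter_pairs_def)

lemma counter_pairs_nonempty: "N \<ge> 2 \<Longrightarrow> counter_pairs N \<noteq> {}"
  by (auto simp: counter_pairs_def intro!: exI[of _ "{0, 1}"])

lemma card_updated:
  assumes "i \<noteq> j"
  shows "card (updated c {i, j}) = (if c i = c j then 2 else 1)"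
proof -
  consider "c i = c j" | "c i < c j" | "c j < c i" by linarith
  then show ?thesis
  proof cases
    case 1
    then have "updated c {i, j} = {i, j}" by (auto simp: updated_def)
    then show ?thesis using 1 assms by simp
  next
    case 2
    then have "updated c {i, j} = {i}" by (auto simp: updated_def)
    then show ?thesis using 2 by simp
  next
    case 3
    then have "updated c {i, j} = {j}" by (auto simp: updated_def)
    then show ?thesis using 3 by simp
  qed
qed

lemma real_choose_two: "real (n choose 2) = real n * (real n - 1) / 2"
  by (cases n) (simp_all add: choose_two real_of_nat_div algebra_simps)

lemma local_speed_eq:
  assumes "N \<ge> 2"
  defines "\<alpha> \<equiv> \<lambda>c l. real (card {i. i < N \<and> c i = l})"
  shows "local_speed N c =
    1 + (\<Sum>l \<in> c ` {..<N}. \<alpha> c l * (\<alpha> c l - 1) / (real N * (real N - 1)))"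
proof -
  define A where "A = (\<lambda>l. {i. i < N \<and> c i = l})"
  define E where "E = (\<lambda>l. {e. e \<subseteq> A l \<and> card e = 2})"
  have finA: "finite (A l)" for l by (simp add: A_def)
  have finE: "finite (E l)" for l
    by (rule finite_subset[of _ "Pow (A l)"]) (auto simp: E_def finA)
  have Esub: "E l \<subseteq> counter_pairs N" for l
    by (auto simp: E_def A_def counter_pairs_def)
  have disj: "E l \<inter> E m = {}" if "l \<noteq> m" for l m
    using that by (auto simp: E_def A_def card_2_iff)
  have card: "real (card (updated c e)) = 1 + (if e \<in> (\<Union>l\<in>c ` {..<N}. E l) then 1 else 0)"
    if "e \<in> counter_pairs N" for e
  proof -
    from that obtain i j where e: "e = {i, j}" "i \<noteq> j" "i < N" "j < N"
      by (auto simp: counter_pairs_def card_2_iff)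
    have "e \<in> (\<Union>l\<in>c ` {..<N}. E l) \<longleftrightarrow> c i = c j"
      using e by (auto simp: E_def A_def)
    then show ?thesis using card_updated[OF e(2), of c] e(1) by simp
  qed
  have "(\<Sum>e\<in>counter_pairs N. real (card (updated c e))) =
      (\<Sum>e\<in>counter_pairs N. 1 + (if e \<in> (\<Union>l\<in>c ` {..<N}. E l) then 1 else 0))"
    by (rule sum.cong) (simp_all add: card)
  also have "\<dots> = real (card (counter_pairs N)) + real (card (\<Union>l\<in>c ` {..<N}. E l))"
  proof -
    have "counter_pairs N \<inter> (\<Union>l\<in>c ` {..<N}. E l) = (\<Union>l\<in>c ` {..<N}. E l)"
      using Esub by blast
    then show ?thesis
      by (simp only: sum.distrib sum.If_cases[OF finite_counter_pairs] Collect_mem_eq) simp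
  qed
  also have "card (\<Union>l\<in>c ` {..<N}. E l) = (\<Sum>l\<in>c ` {..<N}. card (E l))"
    by (rule card_UN_disjoint) (auto simp: finE disj)
  also have "real \<dots> = (\<Sum>l\<in>c ` {..<N}. \<alpha> c l * (\<alpha> c l - 1) / 2)"
    using n_subsets[OF finA] by (simp add: E_def \<alpha>_def A_def real_choose_two)
  finally have "local_speed N c =
      (real N * (real N - 1) / 2 + (\<Sum>l\<in>c ` {..<N}. \<alpha> c l * (\<alpha> c l - 1) / 2))
        / (real N * (real N - 1) / 2)"
    unfolding local_speed_def
    using assms counter_pairs_nonempty[of N]
    by (simp add: integral_pmf_of_set card_counter_pairs real_choose_two)
  also have "\<dots> = 1 + (\<Sum>l\<in>c ` {..<N}. \<alpha> c l * (\<alpha> c l - 1) / 2) / (real N * (real N - 1) / 2)"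
    using assms(1) by (simp add: add_divide_distrib)
  also have "(\<Sum>l\<in>c ` {..<N}. \<alpha> c l * (\<alpha> c l - 1) / 2) / (real N * (real N - 1) / 2)
      = (\<Sum>l\<in>c ` {..<N}. \<alpha> c l * (\<alpha> c l - 1) / (real N * (real N - 1)))"
    by (simp only: sum_divide_distrib) (rule sum.cong, simp_all)
  finally show ?thesis .
qed

text \<open>
  Gaps do not see relabelling and translation of the counters. Hence the gaps of the configuration
  chain, started with at least two counters at the highest level, form a Markov chain with
  kernel \<open>gap_kernel\<close>.
\<close>

lemma gaps_relabel_translate:
  assumes \<sigma>: "bij_betw \<sigma> {..<N} {..<N}" and d: "\<And>i. i < N \<Longrightarrow> d i = c (\<sigma> i) + k"
  shows "gaps N d = gaps N c"
proof -
  have "image_mset \<sigma> (mset_set {..<N}) = mset_set {..<N}"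
    using \<sigma> by (metis bij_betw_def image_mset_mset_set)
  then have "mset (map c [0..<N]) = image_mset c (image_mset \<sigma> (mset_set {..<N}))"
    by (simp add: atLeast0LessThan)
  then have "image_mset (\<lambda>v. v + k) (mset (map c [0..<N])) =
      image_mset (\<lambda>i. c (\<sigma> i) + k) (mset_set {..<N})"
    by (simp only: multiset.map_comp comp_def)
  also have "\<dots> = image_mset d (mset_set {..<N})"
    by (rule image_mset_cong) (simp add: d)
  finally have "image_mset (\<lambda>v. v + k) (mset (map c [0..<N])) = mset (map d [0..<N])"
    by (simp add: atLeast0LessThan)
  then have "sort (map d [0..<N]) = map (\<lambda>v. v + k) (sort (map c [0..<N]))"
    by (intro properties_for_sort) (simp_all add: sorted_map)
  then show ?thesis
    by (auto simp: gaps_def Let_def rev_map)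
qed

lemma config_of_gaps:
  assumes "N \<ge> 2" and s: "s = rev (sort (map c [0..<N]))" and top: "s ! 0 = s ! 1" and "i < N"
  shows "config_of (gaps N c) i = s ! i - s ! 0"
  using \<open>i < N\<close>
proof (induction i)
  case 0
  then show ?case by (simp add: config_of_def)
next
  case (Suc i)
  show ?case
  proof (cases i)
    case 0
    then show ?thesis using top by (simp add: config_of_def)
  next
    case (Suc m)
    have len: "length s = N" by (simp add: s)
    have "sorted_wrt (\<ge>) s" by (simp add: s sorted_wrt_rev)
    then have "s ! i \<ge> s ! Suc i"
      using Suc.prems len by (auto simp: sorted_wrt_iff_nth_less)
    moreover have "m < length (gaps N c)"
      using Suc Suc.prems by (simp add: gaps_def Let_def)
    moreover have "[1..<N - 1] ! m = i"
      using Suc Suc.prems by (subst nth_upt) auto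
    then have "gaps N c ! m = nat (s ! i - s ! Suc i)"
      using \<open>m < length (gaps N c)\<close> by (simp add: gaps_def Let_def s)
    ultimately show ?thesis
      using Suc Suc.IH Suc.prems by (simp add: config_of_def take_Suc_conv_app_nth)
  qed
qed

lemma gaps_step:
  assumes "N \<ge> 2" and "a < N" "b < N" "a \<noteq> b" and top: "c a = c b" "\<And>i. i < N \<Longrightarrow> c i \<le> c a"
  shows "map_pmf (gaps N) (step N c) = gap_kernel N (gaps N c)"
proof -
  define s where "s = rev (sort (map c [0..<N]))"
  define d where "d = config_of (gaps N c)"
  have len: "length s = N" and ms: "mset s = mset (map c [0..<N])" by (simp_all add: s_def)
  obtain \<sigma> where perm: "\<sigma> permutes {..<length (map c [0..<N])}" "permute_list \<sigma> (map c [0..<N]) = s"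
    using mset_eq_permutation[OF ms] by blast
  then have \<sigma>: "bij_betw \<sigma> {..<N} {..<N}"
    by (simp add: permutes_imp_bij)
  have s_nth: "s ! i = c (\<sigma> i)" if "i < N" for i
  proof -
    have "\<sigma> i < N" using bij_betwE[OF \<sigma>] that by blast
    then show ?thesis using that permute_list_nth[OF perm(1), of i] perm(2) by simp
  qed
  have im: "\<sigma> i < N" if "i < N" for i using \<sigma> that by (auto simp: bij_betw_def)
  have inj: "inj_on \<sigma> {..<N}" using \<sigma> by (simp add: bij_betw_def)
  have "s ! 0 = s ! 1"
  proof -
    obtain p q where pq: "p < N" "q < N" "\<sigma> p = a" "\<sigma> q = b"
      using \<sigma> assms(2,3) unfolding bij_betw_def by (metis imageE lessThan_iff)
    define m where "m = max p q"
    have "p \<noteq> q" using pq assms(4) by blast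
    then have "m \<ge> 1" unfolding m_def by linarith
    then have m: "m < N" "m \<ge> 1" "s ! m = c a"
      using pq top(1) s_nth by (auto simp: m_def max_def)
    have dec: "s ! i \<ge> s ! j" if "i \<le> j" "j < N" for i j
    proof -
      have "sorted_wrt (\<ge>) s" by (simp add: s_def sorted_wrt_rev)
      then show ?thesis using that len by (cases "i = j") (auto simp: sorted_wrt_iff_nth_less)
    qed
    have "s ! 1 \<ge> c a" using dec[of 1 m] m by simp
    moreover have "s ! 0 \<ge> s ! 1" using dec[of 0 1] assms(1) by simp
    moreover have "s ! 0 \<le> c a" using top(2)[OF im, of 0] s_nth[of 0] assms(1) by simp
    ultimately show ?thesis by simp
  qed
  then have d: "d i = c (\<sigma> i) - s ! 0" if "i < N" for i
    using config_of_gaps[OF assms(1) s_def, of i] that s_nth by (simp add: d_def)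
  have adv: "gaps N (advance d e) = gaps N (advance c (\<sigma> ` e))" if e: "e \<in> counter_pairs N" for e
  proof (rule gaps_relabel_translate[OF \<sigma>, where k = "- s ! 0"])
    fix i assume i: "i < N"
    have sub: "e \<subseteq> {..<N}" using e by (simp add: counter_pairs_def)
    have "\<sigma> i \<in> \<sigma> ` e \<longleftrightarrow> i \<in> e" using inj i sub by (auto simp: inj_on_def)
    then have "i \<in> updated d e \<longleftrightarrow> \<sigma> i \<in> updated c (\<sigma> ` e)"
      using sub i d by (auto simp: updated_def subset_eq)
    then show "advance d e i = advance c (\<sigma> ` e) (\<sigma> i) + - s ! 0"
      using d[OF i] by (simp add: advance_def)
  qed
  have bij: "bij_betw ((`) \<sigma>) (counter_pairs N) (counter_pairs N)"
  proof (rule bij_betw_imageI)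
    show injp: "inj_on ((`) \<sigma>) (counter_pairs N)"
      by (rule inj_on_subset[OF inj_on_image_Pow[OF inj]]) (auto simp: counter_pairs_def)
    have "(`) \<sigma> ` counter_pairs N \<subseteq> counter_pairs N"
      using im by (auto simp: counter_pairs_def card_image[OF inj_on_subset[OF inj]])
    then show "(`) \<sigma> ` counter_pairs N = counter_pairs N"
      by (intro card_subset_eq) (simp_all add: card_image[OF injp])
  qed
  have ne: "counter_pairs N \<noteq> {}" using counter_pairs_nonempty assms(1) by blast
  have "gap_kernel N (gaps N c) =
      map_pmf (\<lambda>e. gaps N (advance d e)) (pmf_of_set (counter_pairs N))"
    by (simp add: gap_kernel_def step_def d_def pmf.map_comp comp_def)
  also have "\<dots> = map_pmf (\<lambda>e. gaps N (advance c (\<sigma> ` e))) (pmf_of_set (counter_pairs N))"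
    by (rule map_pmf_cong) (simp_all add: adv ne)
  also have "\<dots> = map_pmf (\<lambda>e. gaps N (advance c e))
      (map_pmf ((`) \<sigma>) (pmf_of_set (counter_pairs N)))"
    by (simp add: pmf.map_comp comp_def)
  also have "\<dots> = map_pmf (gaps N) (step N c)"
    by (simp add: map_pmf_of_set_bij_betw[OF bij ne] step_def pmf.map_comp comp_def)
  finally show ?thesis by simp
qed

end

theory Submission
  imports Defs
begin

text \<open>
  In the stationary regime the spread, the sum of \<open>\<bar>c i - c j\<bar>\<close> over all pairs, has zero drift.
  Moving counter \<open>i\<close> up changes it in proportion to the number of counters at or below \<open>i\<close> minus the number of
  those above. The drift is therefore a sum over triples of counters, and summing over the six
  orders of each triple bounds it by a positive multiple of \<open>7 * N * S - N\<^sup>3\<close> up to lower order, where \<open>S\<close> is the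
  number of ordered pairs of equal counters. Hence \<open>S\<close> is on average at least about
  \<open>N\<^sup>2 / 7\<close>, and as the speed is asymptotically \<open>1 + S / N\<^sup>2\<close>, it is at least \<open>8 / 7 - O(1 / N)\<close>,
  which exceeds \<open>1 + sqrt 3 / 27\<close> from some \<open>N\<close> on.
\<close>

section \<open>Spread as a function of the gap state\<close>

definition spread :: "nat \<Rightarrow> config \<Rightarrow> real" where
  "spread N c = (\<Sum>i<N. \<Sum>j<N. of_int \<bar>c i - c j\<bar>)"

lemma spread_nonneg: "0 \<le> spread N c"
  by (simp add: spread_def sum_nonneg)

lemma spread_cong_translate:
  assumes \<sigma>: "bij_betw \<sigma> {..<N} {..<N}" and d: "\<And>i. i < N \<Longrightarrow> d i = c (\<sigma> i) + k"
  shows "spread N d = spread N c"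
proof -
  have "spread N d = (\<Sum>i<N. \<Sum>j<N. of_int \<bar>c (\<sigma> i) - c (\<sigma> j)\<bar>)"
    unfolding spread_def by (intro sum.cong refl) (simp add: d)
  also have "\<dots> = (\<Sum>i<N. \<Sum>j<N. of_int \<bar>c (\<sigma> i) - c j\<bar>)"
    by (intro sum.cong refl sum.reindex_bij_betw[OF \<sigma>])
  also have "\<dots> = spread N c"
    unfolding spread_def
    by (rule sum.reindex_bij_betw[OF \<sigma>, where g = "\<lambda>i. \<Sum>j<N. of_int \<bar>c i - c j\<bar>"])
  finally show ?thesis .
qed

text \<open>Up to a sorting permutation and a translation, \<open>config_of\<close> recovers the
  configuration from its gaps. Two counters at the top are required because \<open>config_of\<close>
  gives counters 0 and 1 the same value.\<close>

lemma spread_config_of_gaps: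
  assumes "a < N" "b < N" "a \<noteq> b" and top: "c a = c b" "\<And>i. i < N \<Longrightarrow> c i \<le> c a"
  shows "spread N (config_of (gaps N c)) = spread N c"
proof -
  define s where "s = rev (sort (map c [0..<N]))"
  have N: "N \<ge> 2" using assms(1-3) by linarith
  have len: "length s = N" and ms: "mset s = mset (map c [0..<N])" by (simp_all add: s_def)
  obtain \<sigma> where perm: "\<sigma> permutes {..<length (map c [0..<N])}" "permute_list \<sigma> (map c [0..<N]) = s"
    using mset_eq_permutation[OF ms] by blast
  then have \<sigma>: "bij_betw \<sigma> {..<N} {..<N}"
    by (simp add: permutes_imp_bij)
  have im: "\<sigma> i < N" if "i < N" for i
    using \<sigma> that by (auto simp: bij_betw_def)
  have s_nth: "s ! i = c (\<sigma> i)" if "i < N" for i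
    using that im[OF that] permute_list_nth[OF perm(1), of i] perm(2) by simp
  obtain p q where pq: "p < N" "q < N" "\<sigma> p = a" "\<sigma> q = b"
    using \<sigma> assms(1,2) unfolding bij_betw_def by (metis imageE lessThan_iff)
  \<comment> \<open>The later of the two top positions in the sorted list is at least 1, so by
    monotonicity \<open>s ! 1\<close> is maximal as well.\<close>
  define m where "m = max p q"
  have "p \<noteq> q" using pq assms(3) by blast
  then have "m \<ge> 1" unfolding m_def by linarith
  then have m: "m < N" "m \<ge> 1" "s ! m = c a"
    using pq top(1) s_nth by (auto simp: m_def max_def)
  have dec: "s ! i \<ge> s ! j" if "i \<le> j" "j < N" for i j
  proof -
    have "sorted_wrt (\<ge>) s" by (simp add: s_def sorted_wrt_rev)
    then show ?thesis using that len by (cases "i = j") (auto simp: sorted_wrt_iff_nth_less)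
  qed
  have "s ! 1 \<ge> c a" using dec[of 1 m] m by simp
  moreover have "s ! 0 \<ge> s ! 1" using dec[of 0 1] N by simp
  moreover have "s ! 0 \<le> c a" using top(2)[OF im, of 0] s_nth[of 0] N by simp
  ultimately have s01: "s ! 0 = s ! 1" by simp
  have "config_of (gaps N c) i = c (\<sigma> i) + - s ! 0" if "i < N" for i
    using config_of_gaps[OF N s_def s01 that] s_nth[OF that] by simp
  then show ?thesis by (rule spread_cong_translate[OF \<sigma>])
qed

text \<open>Either both selected counters sit at level 0 and become the new top pair, or every
  raised counter starts below 0, so that counters 0 and 1 stay maximal. This supplies the hypotheses
  of \<open>spread_config_of_gaps\<close> after one step.\<close>

lemma advance_config_of_top:
  assumes "e \<in> counter_pairs N"
  obtains a b where "a < N" "b < N" "a \<noteq> b"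
    "advance (config_of x) e a = advance (config_of x) e b"
    "\<And>i. advance (config_of x) e i \<le> advance (config_of x) e a"
proof -
  define c where "c = config_of x"
  have c0: "c 0 = 0" "c 1 = 0" and nonpos: "c i \<le> 0" for i
    by (simp_all add: c_def config_of_def)
  obtain a b where e: "e = {a, b}" "a \<noteq> b" "a < N" "b < N"
    using assms by (auto simp: counter_pairs_def card_2_iff)
  show ?thesis
  proof (cases "c a = 0 \<and> c b = 0")
    case True
    then have "updated c e = {a, b}" by (auto simp: updated_def e)
    then have "advance c e a = 1" "advance c e b = 1" "advance c e i \<le> 1" for i
      using True nonpos[of i] by (auto simp: advance_def)
    then show ?thesis using that[of a b] e by (simp add: c_def)
  next
    case False
    have le: "c i < 0" if "i \<in> updated c e" for i
      using that False nonpos[of a] nonpos[of b] by (auto simp: updated_def e)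
    have "advance c e i \<le> 0" for i
      using le[of i] nonpos[of i] by (auto simp: advance_def)
    moreover have "advance c e 0 = 0" "advance c e 1 = 0"
      using le[of 0] le[of 1] c0 by (auto simp: advance_def)
    moreover have "1 < N" using e by linarith
    ultimately show ?thesis using that[of 0 1] by (simp add: c_def)
  qed
qed

section \<open>One-step change of the spread\<close>

lemma spread_advance_diff_abs:
  "\<bar>spread N (advance c e) - spread N c\<bar> \<le> real N * real N"
proof -
  have "\<bar>spread N (advance c e) - spread N c\<bar>
      = \<bar>\<Sum>i<N. \<Sum>j<N. of_int (\<bar>advance c e i - advance c e j\<bar> - \<bar>c i - c j\<bar>)\<bar>"
    by (simp add: spread_def sum_subtractf)
  also have "\<dots> \<le> (\<Sum>i<N. \<Sum>j<N. \<bar>of_int (\<bar>advance c e i - advance c e j\<bar> - \<bar>c i - c j\<bar>)\<bar>)"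
    by (intro order.trans[OF sum_abs] sum_mono sum_abs)
  also have "\<dots> \<le> (\<Sum>i<N. \<Sum>j<N. 1)"
  proof (intro sum_mono)
    fix i j
    have "\<bar>\<bar>advance c e i - advance c e j\<bar> - \<bar>c i - c j\<bar>\<bar> \<le> 1"
      by (auto simp: advance_def)
    then show "\<bar>real_of_int (\<bar>advance c e i - advance c e j\<bar> - \<bar>c i - c j\<bar>)\<bar> \<le> 1"
      by linarith
  qed
  finally show ?thesis by simp
qed

text \<open>For \<open>i < N\<close> this is one more than half the change of \<open>spread\<close>
  when counter \<open>i\<close> alone rises by 1: other counters tied with \<open>i\<close> count +1
  because their distance to it grows, and the extra 1 is the term \<open>j = i\<close>.\<close>

definition rank_excess :: "nat \<Rightarrow> config \<Rightarrow> nat \<Rightarrow> real" where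
  "rank_excess N c i = (\<Sum>j<N. if c j \<le> c i then 1 else -1)"

lemma rank_excess_ge: "- real N \<le> rank_excess N c i"
proof -
  have "(\<Sum>j<N. -1) \<le> rank_excess N c i"
    unfolding rank_excess_def by (intro sum_mono) auto
  then show ?thesis by simp
qed

text \<open>Ordered pairs with at most one updated member give equality. If both members are
  updated, including \<open>i = j\<close>, they are level and keep their distance, while the bound
  charges 2. The factor 2 reflects the two places a raised counter can take in an ordered
  pair.\<close>

lemma spread_advance_diff_le:
  assumes "e \<in> counter_pairs N"
  shows "spread N (advance c e) - spread N c \<le> 2 * (\<Sum>i\<in>updated c e. rank_excess N c i)"
proof -
  let ?U = "updated c e"
  let ?sg = "\<lambda>i j. if c j \<le> c i then 1 else - 1 :: real"
  let ?f = "\<lambda>i j. if i \<in> ?U then ?sg i j else 0"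
  have U: "?U \<subseteq> {..<N}"
    using assms by (auto simp: updated_def counter_pairs_def)
  have eq: "c i = c j" if "i \<in> ?U" "j \<in> ?U" for i j
    using that by (auto simp: updated_def intro: order.antisym)
  have "spread N (advance c e) - spread N c
      = (\<Sum>i<N. \<Sum>j<N. of_int (\<bar>advance c e i - advance c e j\<bar> - \<bar>c i - c j\<bar>))"
    by (simp add: spread_def sum_subtractf)
  also have "\<dots> \<le> (\<Sum>i<N. \<Sum>j<N. ?f i j + ?f j i)"
  proof (intro sum_mono)
    fix i j
    show "of_int (\<bar>advance c e i - advance c e j\<bar> - \<bar>c i - c j\<bar>) \<le> ?f i j + ?f j i"
      using eq[of i j]
      by (cases "i \<in> ?U"; cases "j \<in> ?U"; cases "c i" "c j" rule: linorder_cases)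
        (simp_all add: advance_def)
  qed
  also have "\<dots> = (\<Sum>i<N. \<Sum>j<N. ?f i j) + (\<Sum>i<N. \<Sum>j<N. ?f j i)"
    by (simp only: sum.distrib)
  also have "(\<Sum>i<N. \<Sum>j<N. ?f j i) = (\<Sum>i<N. \<Sum>j<N. ?f i j)"
    by (rule sum.swap)
  also have "(\<Sum>i<N. \<Sum>j<N. ?f i j) = (\<Sum>i<N. if i \<in> ?U then rank_excess N c i else 0)"
    by (intro sum.cong refl) (simp add: rank_excess_def)
  also have "\<dots> = (\<Sum>i\<in>?U. rank_excess N c i)"
    using U by (simp add: sum.If_cases Int_absorb1)
  finally show ?thesis by simp
qed

section \<open>Sums over pairs and triples of counters\<close>

lemma sum_counter_pairs_updated:
  fixes w :: "nat \<Rightarrow> real"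
  shows "(\<Sum>e\<in>counter_pairs N. \<Sum>i\<in>updated c e. w i)
    = (\<Sum>a<N. \<Sum>b<N. if c a \<le> c b then w a else 0) - (\<Sum>a<N. w a)"
proof -
  let ?g = "\<lambda>z. if c (fst z) \<le> c (snd z) then w (fst z) else 0"
  \<comment> \<open>An ordered pair \<open>(a, b)\<close> off the diagonal stands for the update of
    \<open>a\<close> in \<open>{a, b}\<close>, which happens iff \<open>c a \<le> c b\<close>; in a
    tie both orders contribute. Grouping by \<open>{a, b}\<close> gives the sum over selections, and
    the diagonal of the full double sum is subtracted at the end.\<close>
  define Z where "Z = {z \<in> {..<N} \<times> {..<N}. fst z \<noteq> snd z}"
  have finZ: "finite Z" by (simp add: Z_def)
  have inner: "(\<Sum>z\<in>{z\<in>Z. {fst z, snd z} = e}. ?g z) = (\<Sum>i\<in>updated c e. w i)"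
    if "e \<in> counter_pairs N" for e
  proof -
    from that obtain a b where e: "e = {a, b}" "a \<noteq> b" "a < N" "b < N"
      by (auto simp: counter_pairs_def card_2_iff)
    have "{z\<in>Z. {fst z, snd z} = e} = {(a, b), (b, a)}"
      using e by (auto simp: Z_def doubleton_eq_iff)
    then have *: "(\<Sum>z\<in>{z\<in>Z. {fst z, snd z} = e}. ?g z) = ?g (a, b) + ?g (b, a)"
      using e(2) by simp
    consider "c a = c b" | "c a < c b" | "c b < c a" by linarith
    then show ?thesis
    proof cases
      case 1
      then have "updated c e = {a, b}" by (auto simp: updated_def e)
      then show ?thesis using * 1 e(2) by simp
    next
      case 2
      then have "updated c e = {a}" by (auto simp: updated_def e)
      then show ?thesis using * 2 by simp
    next
      case 3
      then have "updated c e = {b}" by (auto simp: updated_def e)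
      then show ?thesis using * 3 by simp
    qed
  qed
  have "(\<Sum>e\<in>counter_pairs N. \<Sum>i\<in>updated c e. w i)
      = (\<Sum>e\<in>counter_pairs N. \<Sum>z\<in>{z\<in>Z. {fst z, snd z} = e}. ?g z)"
    by (intro sum.cong refl) (simp only: inner)
  also have "\<dots> = (\<Sum>z\<in>Z. ?g z)"
    by (rule sum.group[OF finZ finite_counter_pairs]) (auto simp: Z_def counter_pairs_def)
  also have "\<dots> = (\<Sum>z\<in>{..<N} \<times> {..<N}. ?g z) - (\<Sum>z\<in>(\<lambda>a. (a, a)) ` {..<N}. ?g z)"
    by (subst sum_diff[symmetric]) (auto simp: Z_def intro!: sum.cong)
  also have "(\<Sum>z\<in>{..<N} \<times> {..<N}. ?g z) = (\<Sum>a<N. \<Sum>b<N. if c a \<le> c b then w a else 0)"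
    by (simp add: sum.cartesian_product split_def)
  also have "(\<Sum>z\<in>(\<lambda>a. (a, a)) ` {..<N}. ?g z) = (\<Sum>a<N. w a)"
    by (subst sum.reindex) (auto simp: inj_on_def)
  finally show ?thesis .
qed

text \<open>With the diagonal included, this is the sum of the squared level sizes.\<close>

definition ties :: "nat \<Rightarrow> config \<Rightarrow> real" where
  "ties N c = (\<Sum>a<N. \<Sum>b<N. if c a = c b then 1 else 0)"

lemma sum_le_eq_ties:
  "2 * (\<Sum>a<N. \<Sum>b<N. if c a \<le> c b then 1 else 0) = real N * real N + ties N c"
proof -
  let ?f = "\<lambda>a b. if c a \<le> c b then 1 else 0 :: real"
  have "2 * (\<Sum>a<N. \<Sum>b<N. ?f a b) = (\<Sum>a<N. \<Sum>b<N. ?f a b) + (\<Sum>a<N. \<Sum>b<N. ?f b a)"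
    using sum.swap[of ?f "{..<N}" "{..<N}"] by simp
  also have "\<dots> = (\<Sum>a<N. \<Sum>b<N. ?f a b + ?f b a)"
    by (simp only: sum.distrib)
  also have "\<dots> = (\<Sum>a<N. \<Sum>b<N. 1 + (if c a = c b then 1 else 0))"
    by (intro sum.cong refl) auto
  also have "\<dots> = real N * real N + ties N c"
    by (simp add: sum.distrib ties_def)
  finally show ?thesis .
qed

text \<open>The summand over \<open>(a, b, j)\<close> is not bounded well by ties pointwise, but its
  sum over the six orders of a triple depends only on the tie pattern: it is -1 for three distinct
  values, 0 for exactly two equal ones, and 6 for three equal ones.\<close>

lemma sum_rank_excess_le:
  "6 * (\<Sum>a<N. \<Sum>b<N. if c a \<le> c b then rank_excess N c a else 0)
    \<le> 7 * real N * ties N c - real N ^ 3"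
proof -
  let ?q = "\<lambda>a b j. if c a \<le> c b then if c j \<le> c a then 1 else - 1 else 0 :: real"
  let ?E = "\<lambda>a b. if c a = c b then 1 else 0 :: real"
  let ?S = "\<lambda>f :: nat \<Rightarrow> nat \<Rightarrow> nat \<Rightarrow> real. \<Sum>a<N. \<Sum>b<N. \<Sum>j<N. f a b j"
  \<comment> \<open>Two adjacent transpositions of the summation indices; the three remaining
    nontrivial permutations are composed from them.\<close>
  have swap: "?S (\<lambda>a b j. f b a j) = ?S f" for f
    by (rule sum.swap)
  have swap': "?S (\<lambda>a b j. f a j b) = ?S f" for f
    by (rule sum.cong[OF refl]) (rule sum.swap)
  have rot: "?S (\<lambda>a b j. f b j a) = ?S f" for f
    using swap[of "\<lambda>a b j. f b j a"] swap'[of f] by simp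
  have rot': "?S (\<lambda>a b j. f j a b) = ?S f" for f
    using swap'[of "\<lambda>a b j. f j a b"] swap[of f] by simp
  have flip: "?S (\<lambda>a b j. f j b a) = ?S f" for f
    using swap'[of "\<lambda>a b j. f j b a"] rot[of f] by simp
  have add: "?S (\<lambda>a b j. f a b j + g a b j) = ?S f + ?S g" for f g
    by (simp only: sum.distrib)
  have q: "(\<Sum>a<N. \<Sum>b<N. if c a \<le> c b then rank_excess N c a else 0) = ?S ?q"
    by (intro sum.cong refl) (simp add: rank_excess_def)
  have ties: "?S (\<lambda>a b j. ?E a b) = real N * ties N c"
    by (simp add: ties_def sum_distrib_left)
  have "6 * ?S ?q = ?S (\<lambda>a b j. ?q a b j + ?q b a j + ?q a j b + ?q b j a + ?q j a b + ?q j b a)"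
    by (simp only: add swap[of ?q] swap'[of ?q] rot[of ?q] rot'[of ?q] flip[of ?q])
  \<comment> \<open>The right-hand side takes the values -1, 4/3 and 6 on the three tie patterns.
    The slope 7/3 is the least one that reaches 6 for three equal values.\<close>
  also have "\<dots> \<le> ?S (\<lambda>a b j. 7 / 3 * (?E a b + ?E b j + ?E j a) + - 1)"
    by (intro sum_mono) auto
  also have "\<dots> = 7 / 3 * (?S (\<lambda>a b j. ?E a b) + ?S (\<lambda>a b j. ?E b j) + ?S (\<lambda>a b j. ?E j a))
      - real N ^ 3"
    by (simp only: add sum_distrib_left[symmetric]) (simp add: power3_eq_cube)
  also have "?S (\<lambda>a b j. ?E b j) = ?S (\<lambda>a b j. ?E a b)"
    by (rule rot)
  also have "?S (\<lambda>a b j. ?E j a) = ?S (\<lambda>a b j. ?E a b)"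
    by (rule rot')
  finally show ?thesis
    by (simp only: q ties mult.assoc) simp
qed

text \<open>With weight 1, \<open>sum_counter_pairs_updated\<close> counts the updates over all
  selections, which makes the speed an affine function of \<open>ties\<close>.\<close>

lemma local_speed_ties:
  assumes "N \<ge> 2"
  shows "real N * (real N - 1) * local_speed N c = real N * real N + ties N c - 2 * real N"
proof -
  have "(\<Sum>e\<in>counter_pairs N. real (card (updated c e)))
      = (\<Sum>e\<in>counter_pairs N. \<Sum>i\<in>updated c e. 1)"
    by simp
  also have "2 * \<dots> = real N * real N + ties N c - 2 * real N"
    unfolding sum_counter_pairs_updated using sum_le_eq_ties[where N=N and c=c] by simp
  finally show ?thesis
    using assms counter_pairs_nonempty[OF assms]
    by (simp add: local_speed_def integral_pmf_of_set card_counter_pairs real_choose_two)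
qed

lemma spread_drift_le:
  assumes "N \<ge> 2"
  shows "3 * (\<Sum>e\<in>counter_pairs N. spread N (advance c e) - spread N c)
    \<le> real N * (7 * (real N * (real N - 1)) * local_speed N c
        - 8 * real N * real N + 20 * real N)"
proof -
  define Q where "Q = (\<Sum>a<N. \<Sum>b<N. if c a \<le> c b then rank_excess N c a else 0)"
  have "(\<Sum>e\<in>counter_pairs N. spread N (advance c e) - spread N c)
      \<le> (\<Sum>e\<in>counter_pairs N. 2 * (\<Sum>i\<in>updated c e. rank_excess N c i))"
    by (intro sum_mono spread_advance_diff_le)
  also have "\<dots> = 2 * (Q - (\<Sum>a<N. rank_excess N c a))"
    by (simp only: sum_distrib_left[symmetric] sum_counter_pairs_updated Q_def)
  finally have "3 * (\<Sum>e\<in>counter_pairs N. spread N (advance c e) - spread N c)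
      \<le> 7 * real N * ties N c - real N ^ 3 - 6 * (\<Sum>a<N. rank_excess N c a)"
    using sum_rank_excess_le[where N=N and c=c, folded Q_def] by (simp add: mult.assoc)
  \<comment> \<open>The diagonal correction is bounded crudely; it costs only order
    \<open>N^2\<close> against the main terms of order \<open>N^3\<close>.\<close>
  moreover have "(\<Sum>a<N. - real N) \<le> (\<Sum>a<N. rank_excess N c a)"
    by (intro sum_mono rank_excess_ge)
  ultimately have "3 * (\<Sum>e\<in>counter_pairs N. spread N (advance c e) - spread N c)
      \<le> 7 * real N * ties N c - real N ^ 3 + 6 * (real N * real N)"
    by simp
  also have "ties N c = real N * (real N - 1) * local_speed N c - real N * real N + 2 * real N"
    using local_speed_ties[OF assms] by simp
  also have "7 * real N * \<dots> - real N ^ 3 + 6 * (real N * real N)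
      = real N * (7 * (real N * (real N - 1)) * local_speed N c
        - 8 * real N * real N + 20 * real N)"
    by (simp add: algebra_simps power3_eq_cube)
  finally show ?thesis .
qed

lemma integral_bind_pmf_bounded:
  fixes f :: "'b \<Rightarrow> real"
  assumes "\<And>y. \<bar>f y\<bar> \<le> B"
  shows "measure_pmf.expectation (bind_pmf p K) f
    = measure_pmf.expectation p (\<lambda>x. measure_pmf.expectation (K x) f)"
  unfolding measure_pmf_bind
  by (rule integral_bind[where K = "count_space UNIV" and B = B and B' = 1])
    (use assms measurable_measure_pmf[of K] in
      \<open>auto simp: measure_pmf.emeasure_space_1 intro: measure_pmf.finite_measure\<close>)

text \<open>The function \<open>f\<close> itself need not be integrable with respect to \<open>p\<close>; hence the truncation.\<close>

lemma stationary_drift_zero: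
  fixes f :: "'a \<Rightarrow> real"
  assumes stat: "bind_pmf p K = p"
    and nonneg: "\<And>x. 0 \<le> f x"
    and bound: "\<And>x y. x \<in> set_pmf p \<Longrightarrow> y \<in> set_pmf (K x) \<Longrightarrow> \<bar>f y - f x\<bar> \<le> B"
  defines "h \<equiv> \<lambda>x. measure_pmf.expectation (K x) (\<lambda>y. f y - f x)"
  shows "integrable p h" "measure_pmf.expectation p h = 0"
proof -
  define g where "g = (\<lambda>(M::nat) x. min (f x) (real M))"
  define k where "k = (\<lambda>M x. measure_pmf.expectation (K x) (\<lambda>y. g M y - g M x))"
  have g_bound: "\<bar>g M x\<bar> \<le> real M" for M x
    using nonneg[of x] by (auto simp: g_def)
  have int_g: "integrable (measure_pmf q) (g M)" for M and q :: "'a pmf"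
    by (rule measure_pmf.integrable_const_bound[where B = "real M"]) (auto simp: g_bound)
  have abs_le: "\<bar>measure_pmf.expectation (K x) u\<bar> \<le> B"
    if "\<And>y. y \<in> set_pmf (K x) \<Longrightarrow> \<bar>u y\<bar> \<le> B" for u :: "'a \<Rightarrow> real" and x
  proof -
    have int: "integrable (K x) u"
      by (rule measure_pmf.integrable_const_bound[where B = B]) (auto simp: AE_measure_pmf_iff that)
    have "\<bar>measure_pmf.expectation (K x) u\<bar> \<le> measure_pmf.expectation (K x) (\<lambda>y. \<bar>u y\<bar>)"
      by (rule integral_abs_bound)
    also have "\<dots> \<le> measure_pmf.expectation (K x) (\<lambda>y. B)"
      by (rule integral_mono_AE) (auto simp: int AE_measure_pmf_iff that)
    finally show ?thesis by simp
  qed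
  have h_bound: "\<bar>h x\<bar> \<le> B" if "x \<in> set_pmf p" for x
    unfolding h_def using bound[OF that] by (rule abs_le)
  then show "integrable p h"
    by (intro measure_pmf.integrable_const_bound[where B = B]) (auto simp: AE_measure_pmf_iff)
  have k_bound: "\<bar>k M x\<bar> \<le> B" if "x \<in> set_pmf p" for M x
    unfolding k_def
  proof (rule abs_le)
    fix y assume "y \<in> set_pmf (K x)"
    then have "\<bar>f y - f x\<bar> \<le> B" using bound that by blast
    then show "\<bar>g M y - g M x\<bar> \<le> B" by (auto simp: g_def)
  qed
  have k_eq: "k M x = measure_pmf.expectation (K x) (g M) - g M x" for M x
    unfolding k_def by (subst Bochner_Integration.integral_diff) (auto simp: int_g)
  have k_zero: "measure_pmf.expectation p (k M) = 0" for M
  proof -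
    have "integrable p (k M)"
      by (rule measure_pmf.integrable_const_bound[where B = B])
        (auto simp: AE_measure_pmf_iff k_bound)
    then have "integrable p (\<lambda>x. k M x + g M x)"
      by (intro Bochner_Integration.integrable_add int_g)
    then have "measure_pmf.expectation p (k M)
        = measure_pmf.expectation p (\<lambda>x. k M x + g M x) - measure_pmf.expectation p (g M)"
      by (subst Bochner_Integration.integral_diff[symmetric]) (auto simp: int_g)
    also have "\<dots> = measure_pmf.expectation (bind_pmf p K) (g M) - measure_pmf.expectation p (g M)"
      by (simp add: k_eq integral_bind_pmf_bounded[OF g_bound])
    finally show ?thesis by (simp add: stat)
  qed
  have "(\<lambda>M. k M x) \<longlonglongrightarrow> h x" if x: "x \<in> set_pmf p" for x
  proof (rule tendsto_eventually)
    have "k M x = h x" if "f x + B \<le> real M" for M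
      unfolding k_def h_def
    proof (rule integral_cong_AE)
      have "g M y - g M x = f y - f x" if "y \<in> set_pmf (K x)" for y
        using bound[OF x that] \<open>f x + B \<le> real M\<close> by (auto simp: g_def)
      then show "AE y in K x. g M y - g M x = f y - f x"
        by (simp add: AE_measure_pmf_iff)
    qed simp_all
    moreover have "\<forall>\<^sub>F M in sequentially. f x + B \<le> real M"
      by (meson eventually_sequentiallyI of_nat_le_iff order_trans real_arch_simple)
    ultimately show "\<forall>\<^sub>F M in sequentially. k M x = h x"
      by (simp add: eventually_mono)
  qed
  then have "(\<lambda>M. measure_pmf.expectation p (k M)) \<longlonglongrightarrow> measure_pmf.expectation p h"
    by (intro integral_dominated_convergence[where w = "\<lambda>_. B"])
      (auto simp: AE_measure_pmf_iff k_bound)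
  then show "measure_pmf.expectation p h = 0"
    by (simp add: k_zero LIMSEQ_const_iff)
qed

lemma expectation_gap_kernel_spread:
  assumes "N \<ge> 2"
  shows "real N * (real N - 1) / 2 * measure_pmf.expectation (gap_kernel N x)
      (\<lambda>y. spread N (config_of y) - spread N (config_of x))
    = (\<Sum>e\<in>counter_pairs N. spread N (advance (config_of x) e) - spread N (config_of x))"
proof -
  have "spread N (config_of (gaps N (advance (config_of x) e))) = spread N (advance (config_of x) e)"
    if "e \<in> counter_pairs N" for e
    using advance_config_of_top[OF that, of x] spread_config_of_gaps by metis
  then show ?thesis
    using assms counter_pairs_nonempty[OF assms]
    by (simp add: gap_kernel_def step_def integral_pmf_of_set card_counter_pairs real_choose_two)
qed

lemma abs_spread_gap_kernel_diff:
  assumes "N \<ge> 2" "y \<in> set_pmf (gap_kernel N x)"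
  shows "\<bar>spread N (config_of y) - spread N (config_of x)\<bar> \<le> real N * real N"
proof -
  obtain e where e: "e \<in> counter_pairs N" "y = gaps N (advance (config_of x) e)"
    using assms counter_pairs_nonempty[OF assms(1)] by (auto simp: gap_kernel_def step_def)
  have "spread N (config_of y) = spread N (advance (config_of x) e)"
    using advance_config_of_top[OF e(1), of x] spread_config_of_gaps e(2) by metis
  then show ?thesis by (simp add: spread_advance_diff_abs)
qed

lemma ties_bounds: "0 \<le> ties N c" "ties N c \<le> real N * real N"
proof -
  show "0 \<le> ties N c" by (auto simp: ties_def intro!: sum_nonneg)
  have "ties N c \<le> (\<Sum>a<N. \<Sum>b<N. 1)"
    unfolding ties_def by (intro sum_mono) auto
  then show "ties N c \<le> real N * real N" by simp
qed

lemma integrable_local_speed: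
  assumes "N \<ge> 2"
  shows "integrable (measure_pmf p) (\<lambda>x. local_speed N (config_of x))"
proof -
  let ?n = "real N * (real N - 1)"
  have n: "?n \<noteq> 0" using assms by simp
  have eq: "local_speed N c = (real N * real N + ties N c - 2 * real N) / ?n" for c
    by (simp only: local_speed_ties[OF assms, symmetric] nonzero_mult_div_cancel_left[OF n])
  have "integrable (measure_pmf p) (\<lambda>x. ties N (config_of x))"
    by (rule measure_pmf.integrable_const_bound[where B = "real N * real N"])
      (auto simp: ties_bounds)
  then show ?thesis by (simp add: eq)
qed

theorem speed_ge:
  assumes "N \<ge> 2" "stationary N p"
  shows "speed N p \<ge> (8 * real N - 20) / (7 * (real N - 1))"
proof -
  let ?f = "\<lambda>x. spread N (config_of x)"
  let ?h = "\<lambda>x. measure_pmf.expectation (gap_kernel N x) (\<lambda>y. ?f y - ?f x)"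
  let ?L = "\<lambda>x. local_speed N (config_of x)"
  let ?A = "7 * (real N - 1)" and ?B = "8 * real N - 20"
  have stat: "bind_pmf p (gap_kernel N) = p"
    using assms(2) by (simp add: stationary_def)
  note drift = stationary_drift_zero[where f = ?f, OF stat spread_nonneg
      abs_spread_gap_kernel_diff[OF assms(1)]]
  have N: "real N > 0" "real N - 1 > 0" using assms(1) by auto
  have "3 * (real N - 1) / (2 * real N) * ?h x \<le> ?A * ?L x - ?B" for x
  proof -
    have "real N * real N * (3 * (real N - 1) / (2 * real N) * ?h x)
        = 3 * (real N * (real N - 1) / 2 * ?h x)"
      using N by simp
    also have "\<dots> \<le> real N * real N * (?A * ?L x - ?B)"
      using spread_drift_le[OF assms(1), of "config_of x"]
      unfolding expectation_gap_kernel_spread[OF assms(1), symmetric]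
      by (simp add: algebra_simps)
    finally show ?thesis
      by (rule mult_left_le_imp_le) (use N in simp)
  qed
  then have "measure_pmf.expectation p (\<lambda>x. 3 * (real N - 1) / (2 * real N) * ?h x)
      \<le> measure_pmf.expectation p (\<lambda>x. ?A * ?L x - ?B)"
    by (intro integral_mono integrable_mult_right drift(1) Bochner_Integration.integrable_diff
        integrable_local_speed[OF assms(1)]) auto
  also have "measure_pmf.expectation p (\<lambda>x. 3 * (real N - 1) / (2 * real N) * ?h x) = 0"
    by (subst integral_mult_right_zero) (simp only: drift(2) mult_zero_right)
  also have "measure_pmf.expectation p (\<lambda>x. ?A * ?L x - ?B) = ?A * speed N p - ?B"
    unfolding speed_def
    by (subst Bochner_Integration.integral_diff)
      (use integrable_local_speed[OF assms(1), of p] in simp_all)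
  finally have "?B \<le> speed N p * ?A" by (simp only: diff_ge_0_iff_ge mult.commute)
  moreover have "?A > 0" using N by simp
  ultimately show ?thesis by (simp only: pos_divide_le_eq)
qed

theorem theorem3:
  fixes \<pi> :: "nat \<Rightarrow> nat list pmf"
  assumes "\<And>N. N \<ge> 3 \<Longrightarrow> stationary N (\<pi> N)"
  shows "\<exists>\<epsilon> :: nat \<Rightarrow> real. \<epsilon> \<in> o(\<lambda>_. 1) \<and>
           (\<forall>N\<ge>3. speed N (\<pi> N) \<ge> (1 + \<epsilon> N) * (1 + sqrt 3 / 27))"
proof -
  let ?c = "1 + sqrt 3 / 27"
  have c: "?c > 0" by (simp add: add_pos_nonneg)
  have "sqrt 3 \<le> 9 / 5" by (rule real_le_lsqrt) (simp_all add: power2_eq_square)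
  then have c_le: "?c \<le> 16 / 15" by simp
  define \<epsilon> where "\<epsilon> = (\<lambda>N. min 0 (speed N (\<pi> N) / ?c - 1))"
  have "\<epsilon> N = 0" if "N \<ge> 24" for N
  proof -
    have "16 / 15 \<le> (8 * real N - 20) / (7 * (real N - 1))"
      using that by (simp add: field_simps)
    also have "\<dots> \<le> speed N (\<pi> N)"
      using speed_ge[of N] assms that by simp
    finally have "?c \<le> speed N (\<pi> N)" using c_le by linarith
    then have "speed N (\<pi> N) / ?c \<ge> 1" using c by simp
    then show ?thesis by (simp add: \<epsilon>_def)
  qed
  then have "\<forall>\<^sub>F N in sequentially. \<epsilon> N = 0"
    by (rule eventually_sequentiallyI)
  then have "\<epsilon> \<in> o(\<lambda>_. 1)"
    by (intro smalloI_tendsto) (auto intro: tendsto_eventually)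
  moreover have "speed N (\<pi> N) \<ge> (1 + \<epsilon> N) * ?c" for N
  proof -
    have "1 + \<epsilon> N \<le> speed N (\<pi> N) / ?c" by (simp add: \<epsilon>_def)
    then show ?thesis using c by (simp only: pos_le_divide_eq)
  qed
  ultimately show ?thesis by blast
qed

end
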